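(* Let $(X,\|\cdot\|)$ be a normed space, let $I$ be a nonempty (finite or infinite) set of indices, and let $(T_i)_{i\in I}$ be a family of nonexpansive mappings from $X$ to itself (these mappings may coincide). Let $c:\mathbb{N}\cup\{0\}\to I$ be an arbitrary function, and for each $k\in\mathbb{N}\cup\{0\}$ let $S_k:=T_{c(k)}T_{c(k-1)}\cdots T_{c(0)}$ (composition; $S_0=T_{c(0)}$). Then: (a) If $(S_k(x))_{k=0}^\infty$ is bounded for some $x\in X$, then $(S_k)_{k=0}^\infty$ is uniformly bounded on all nonempty and bounded subsets of $X$, namely for each nonempty and bounded set $B\subseteq X$ there exists $r_B>0$ such that $\|S_k(y)\|<r_B$ for all $k\in\mathbb{N}\cup\{0\}$ and all $y\in B$. In particular, $(S_k(y))_{k=0}^\infty$ is bounded for all $y\in X$. (b) $(S_k(x))_{k=0}^\infty$ is bounded for some $x\in X$ if and only if $(S_k(x))_{k=0}^\infty$ is bounded for all $x\in X$. (c) If $\lim_{k\to\infty}\|S_k(x)\|=\infty$ for some $x\in X$, then $\lim_{k\to\infty}\|S_k(\cdot)\|=\infty$ uniformly on nonempty and bounded sets, that is, for each nonempty and bounded set $B\subseteq X$ and each $r>0$ there exists $\widetilde{k}\in\mathbb{N}$ such that $\|S_k(y)\|>r$ for all integers $k>\widetilde{k}$ and all $y\in B$. In particular, $\lim_{k\to\infty}\|S_k(y)\|=\infty$ for all $y\in X$. (d) $(S_k(x))_{k=0}^\infty$ is unbounded for some $x\in X$ if and only if $(S_k(x))_{k=0}^\infty$ is unbounded for all $x\in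 X$. (e) If $X$ is a real Hilbert space and $T:X\to X$ is strongly nonexpansive and fixed point free, then $\lim_{k\to\infty}\|T^k(\cdot)\|=\infty$ uniformly on nonempty and bounded subsets of $X$ (in the sense of (c), with $T^k$, the $k$-fold composition of $T$ with itself, in place of $S_k$).
   Context: $\mathbb{N}$ denotes the positive integers. A mapping $T:X\to X$ on a normed space is nonexpansive if $\|T(x)-T(y)\|\le\|x-y\|$ for all $x,y\in X$. It is strongly nonexpansive if it is nonexpansive and, for all sequences $(x^k)_{k=0}^\infty$ and $(y^k)_{k=0}^\infty$ in $X$ satisfying both $\sup\{\|x^k-y^k\|\,:\,k\in\mathbb{N}\cup\{0\}\}<\infty$ and $\lim_{k\to\infty}(\|x^k-y^k\|-\|T(x^k)-T(y^k)\|)=0$, one has $\lim_{k\to\infty}\big((x^k-y^k)-(T(x^k)-T(y^k))\big)=0$. Fixed point free means that there is no $x\in X$ with $T(x)=x$. Hilbert spaces are assumed to be different from $\{0\}$. *)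

theory Defs
  imports "HOL-Analysis.Analysis"
begin

definition nonexpansive :: "('a::real_normed_vector \<Rightarrow> 'a) \<Rightarrow> bool" where
  "nonexpansive T \<longleftrightarrow> (\<forall>x y. norm (T x - T y) \<le> norm (x - y))"

lemma nonexpansive_iff_lipschitz: "nonexpansive T \<longleftrightarrow> 1-lipschitz_on UNIV T"
  by (simp add: nonexpansive_def lipschitz_on_def dist_norm)

definition strongly_nonexpansive :: "('a::real_normed_vector \<Rightarrow> 'a) \<Rightarrow> bool" where
  "strongly_nonexpansive T \<longleftrightarrow>
     nonexpansive T \<and>
     (\<forall>x y :: nat \<Rightarrow> 'a.
        bdd_above (range (\<lambda>k. norm (x k - y k))) \<longrightarrow>
        (\<lambda>k. norm (x k - y k) - norm (T (x k) - T (y k))) \<longlonglongrightarrow> 0 \<longrightarrow>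
        (\<lambda>k. (x k - y k) - (T (x k) - T (y k))) \<longlonglongrightarrow> 0)"

definition fixed_point_free :: "('a \<Rightarrow> 'a) \<Rightarrow> bool" where
  "fixed_point_free T \<longleftrightarrow> (\<nexists>x. T x = x)"

primrec iter_comp :: "('i \<Rightarrow> 'a \<Rightarrow> 'a) \<Rightarrow> (nat \<Rightarrow> 'i) \<Rightarrow> nat \<Rightarrow> 'a \<Rightarrow> 'a" where
  "iter_comp T c 0 = T (c 0)"
| "iter_comp T c (Suc k) = T (c (Suc k)) \<circ> iter_comp T c k"

definition uniformly_bounded_on_bounded_sets ::
    "(nat \<Rightarrow> 'a \<Rightarrow> 'a::real_normed_vector) \<Rightarrow> bool" where
  "uniformly_bounded_on_bounded_sets F \<longleftrightarrow>
     (\<forall>B. B \<noteq> {} \<and> bounded B \<longrightarrow> (\<exists>r>0. \<forall>k. \<forall>y\<in>B. norm (F k y) < r))"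

definition norm_diverges_uniformly_on_bounded_sets ::
    "(nat \<Rightarrow> 'a \<Rightarrow> 'a::real_normed_vector) \<Rightarrow> bool" where
  "norm_diverges_uniformly_on_bounded_sets F \<longleftrightarrow>
     (\<forall>B. B \<noteq> {} \<and> bounded B \<longrightarrow>
        (\<forall>r>0. \<exists>k0\<ge>1. \<forall>k>k0. \<forall>y\<in>B. norm (F k y) > r))"

end

theory Submission
  imports Defs
begin

text \<open>
  Parts (a) to (d) hold because every \<open>S\<^sub>k\<close> is nonexpansive, so that \<open>\<parallel>S\<^sub>k y\<parallel>\<close> and \<open>\<parallel>S\<^sub>k x\<parallel>\<close>
  differ by at most \<open>\<parallel>y - x\<parallel>\<close>, uniformly in \<open>k\<close>.

  For part (e) let \<open>x\<^sub>k = U\<^sup>k x\<close> and \<open>v\<^sub>k = U x\<^sub>k - x\<^sub>k\<close>. The norms of the \<open>v\<^sub>k\<close> decrease to some \<open>d\<close>.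
  Strong nonexpansiveness, applied to the orbit and its shift, gives \<open>v\<^bsub>k+1\<^esub> - v\<^sub>k \<rightarrow> 0\<close>; hence
  \<open>x\<^bsub>k+m\<^esub> - x\<^sub>k\<close> is asymptotically \<open>m v\<^sub>k\<close>, and \<open>\<parallel>x\<^sub>m - x\<^sub>0\<parallel> \<ge> \<parallel>x\<^bsub>k+m\<^esub> - x\<^sub>k\<parallel>\<close> yields
  \<open>\<parallel>x\<^sub>m - x\<^sub>0\<parallel> \<ge> m d\<close>. If \<open>d > 0\<close>, the orbit diverges. If \<open>d = 0\<close> and the orbit does not diverge, it has
  a bounded subsequence of approximate fixed points, whose asymptotic center is a fixed point of \<open>U\<close>.
\<close>

section \<open>Nonexpansive maps and their compositions\<close>

lemma nonexpansiveD: "nonexpansive T \<Longrightarrow> norm (T x - T y) \<le> norm (x - y)"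
  by (simp add: nonexpansive_def)

lemma nonexpansive_comp: "nonexpansive S \<Longrightarrow> nonexpansive T \<Longrightarrow> nonexpansive (S \<circ> T)"
  unfolding nonexpansive_def o_apply by (blast intro: order_trans)

lemma nonexpansive_funpow: "nonexpansive T \<Longrightarrow> nonexpansive (T ^^ k)"
proof (induction k)
  case 0
  show ?case by (simp add: nonexpansive_def)
next
  case (Suc k)
  then show ?case
    by (simp only: funpow.simps nonexpansive_comp)
qed

lemma nonexpansive_iter_comp: "(\<And>k. nonexpansive (T (c k))) \<Longrightarrow> nonexpansive (iter_comp T c k)"
  by (induction k) (simp_all add: nonexpansive_comp)

lemma nonexpansive_norm_le:
  assumes "nonexpansive T"
  shows "norm (T y) \<le> norm (T x) + norm (y - x)"
  using norm_triangle_sub[of "T y" "T x"] nonexpansiveD[OF assms, of y x] by linarith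

section \<open>Comparison of orbits, uniformly on bounded sets\<close>

lemma uniformly_bounded_if_bounded_orbit:
  assumes ne: "\<And>k. nonexpansive (F k)" and bd: "bounded (range (\<lambda>k. F k x))"
  shows "uniformly_bounded_on_bounded_sets F"
  unfolding uniformly_bounded_on_bounded_sets_def
proof (intro allI impI)
  fix B :: "'a set"
  assume B: "B \<noteq> {} \<and> bounded B"
  obtain a where a: "\<And>k. norm (F k x) \<le> a"
    using bd unfolding bounded_iff by auto
  obtain b where b: "\<And>y. y \<in> B \<Longrightarrow> norm y \<le> b"
    using B unfolding bounded_iff by auto
  \<comment> \<open>The absolute values and the summand 1 make the bound positive and strict without
    any discussion of the signs of \<open>a\<close> and \<open>b\<close>.\<close>
  have *: "norm (F k y) < \<bar>a\<bar> + \<bar>b\<bar> + norm x + 1" if "y \<in> B" for k y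
    using nonexpansive_norm_le[OF ne, of k y x] a[of k] b[OF that] norm_triangle_ineq4[of y x]
    by linarith
  have "\<bar>a\<bar> + \<bar>b\<bar> + norm x + 1 > 0"
    using norm_ge_zero[of x] by linarith
  with * show "\<exists>r>0. \<forall>k. \<forall>y\<in>B. norm (F k y) < r"
    by blast
qed

lemma bounded_orbit_if_uniformly_bounded:
  assumes "uniformly_bounded_on_bounded_sets F"
  shows "bounded (range (\<lambda>k. F k y))"
proof -
  have "{y} \<noteq> {} \<and> bounded {y}"
    by simp
  from assms[unfolded uniformly_bounded_on_bounded_sets_def, rule_format, OF this]
  obtain r where "\<And>k. norm (F k y) < r"
    by auto
  then show ?thesis
    by (intro boundedI[of _ r]) (auto simp: less_imp_le)
qed

lemma norm_diverges_uniformly_if_orbit_diverges: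
  assumes ne: "\<And>k. nonexpansive (F k)"
    and lim: "filterlim (\<lambda>k. norm (F k x)) at_top sequentially"
  shows "norm_diverges_uniformly_on_bounded_sets F"
  unfolding norm_diverges_uniformly_on_bounded_sets_def
proof (intro allI impI)
  fix B :: "'a set" and r :: real
  assume B: "B \<noteq> {} \<and> bounded B"
  obtain b where b: "\<And>y. y \<in> B \<Longrightarrow> norm y \<le> b"
    using B unfolding bounded_iff by auto
  have "\<forall>\<^sub>F k in sequentially. norm (F k x) > r + norm x + b"
    using lim unfolding filterlim_at_top_dense by blast
  then obtain K where K: "\<And>k. k \<ge> K \<Longrightarrow> norm (F k x) > r + norm x + b"
    unfolding eventually_sequentially by blast
  \<comment> \<open>The estimate is used with \<open>x\<close> and \<open>y\<close> interchanged: a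
    large value at \<open>x\<close> forces one at \<open>y\<close>. The maximum with 1 serves the
    demand \<open>k0\<ge>1\<close>.\<close>
  have "norm (F k y) > r" if "k > max 1 K" "y \<in> B" for k y
    using nonexpansive_norm_le[OF ne, of k x y] K[of k] that b[OF that(2)]
      norm_triangle_ineq4[of x y]
    by simp
  then show "\<exists>k0\<ge>1. \<forall>k>k0. \<forall>y\<in>B. norm (F k y) > r"
    by (intro exI[of _ "max 1 K"]) auto
qed

lemma orbit_diverges_if_norm_diverges_uniformly:
  assumes "norm_diverges_uniformly_on_bounded_sets F"
  shows "filterlim (\<lambda>k. norm (F k y)) at_top sequentially"
  \<comment> \<open>Testing only thresholds above 0 suffices, and uniform divergence speaks of
    positive \<open>r\<close> only.\<close>
  unfolding filterlim_at_top_gt[where c = 0] eventually_sequentially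
proof (intro allI impI)
  fix r :: real
  assume r: "r > 0"
  have "{y} \<noteq> {} \<and> bounded {y}"
    by simp
  from assms[unfolded norm_diverges_uniformly_on_bounded_sets_def, rule_format, OF this r]
  obtain k0 where "\<forall>k>k0. norm (F k y) > r"
    by auto
  then show "\<exists>N. \<forall>k\<ge>N. r \<le> norm (F k y)"
    by (intro exI[of _ "Suc k0"]) (simp add: Suc_le_eq order_less_imp_le)
qed

section \<open>Asymptotic centers and approximate fixed points\<close>

text \<open>This is the parallelogram law for \<open>y - a\<close> and \<open>y - b\<close>. The
  negative term is the gain of the midpoint over the mean of the squared distances; it forces almost
  optimal centers to lie close together.\<close>

lemma parallelogram_midpoint:
  fixes a b y :: "'a::real_inner"
  shows "(norm (y - (1/2) *\<^sub>R (a + b)))\<^sup>2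
    = ((norm (y - a))\<^sup>2 + (norm (y - b))\<^sup>2) / 2 - (norm (a - b))\<^sup>2 / 4"
proof -
  have "(y - a) + (y - b) = (y + y) - (a + b)"
    by simp
  then have "y - (1/2) *\<^sub>R (a + b) = (1/2) *\<^sub>R ((y - a) + (y - b))"
    by (simp only: scaleR_diff_right scaleR_half_double)
  moreover have "(norm ((1/2) *\<^sub>R (p + q)))\<^sup>2
      = ((norm p)\<^sup>2 + (norm q)\<^sup>2) / 2 - (norm (q - p))\<^sup>2 / 4" for p q :: 'a
    by (simp add: power_divide power2_norm_eq_inner inner_add_left inner_add_right inner_diff_left
        inner_diff_right inner_commute[of q p] add_divide_distrib diff_divide_distrib)
  ultimately show ?thesis
    by simp
qed

text \<open>
  The point \<open>z\<close> below is the asymptotic center of \<open>y\<close> along \<open>F\<close>, and \<open>\<rho>\<close> the square of its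
  asymptotic radius.
\<close>

lemma asymptotic_center:
  fixes y :: "'b \<Rightarrow> 'a::{real_inner,complete_space}"
  assumes F: "F \<noteq> bot" and bd: "\<forall>\<^sub>F j in F. norm (y j) \<le> r"
  obtains z where
    "\<And>w. (\<And>e. e > 0 \<Longrightarrow> \<forall>\<^sub>F j in F. norm (y j - w) \<le> norm (y j - z) + e) \<Longrightarrow> w = z"
proof -
  \<comment> \<open>\<open>P s w\<close> says that the ball around \<open>w\<close> of squared
    radius \<open>s\<close> eventually contains \<open>y\<close>. Squares fit the parallelogram
    law.\<close>
  define P where "P s w \<longleftrightarrow> (\<forall>\<^sub>F j in F. (norm (y j - w))\<^sup>2 \<le> s)" for s w
  define \<rho> where "\<rho> = Inf {s. \<exists>w. P s w}"
  have "\<forall>\<^sub>F j in F. (norm (y j - 0))\<^sup>2 \<le> r\<^sup>2"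
    using bd by eventually_elim (simp add: power_mono)
  then have ex: "P (r\<^sup>2) 0"
    by (simp add: P_def)
  have nonneg: "s \<ge> 0" if Psw: "P s w" for s w
  proof -
    obtain j where "(norm (y j - w))\<^sup>2 \<le> s"
      using eventually_happens'[OF F Psw[unfolded P_def]] by blast
    then show ?thesis
      using order_trans[OF zero_le_power2] by blast
  qed
  have bdd: "bdd_below {s. \<exists>w. P s w}"
    using nonneg by (intro bdd_belowI[of _ 0]) auto
  have \<rho>_le: "\<rho> \<le> s" if "P s w" for s w
    unfolding \<rho>_def using that by (intro cInf_lower bdd) auto
  have near: "\<exists>w. P (\<rho> + e) w" if "e > 0" for e
  proof -
    have "{s. \<exists>w. P s w} \<noteq> {}"
      using ex by blast
    moreover have "\<rho> < \<rho> + e"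
      using that by simp
    ultimately obtain s w where "P s w" "s < \<rho> + e"
      using cInf_lessD[of "{s. \<exists>w. P s w}" "\<rho> + e"] unfolding \<rho>_def by blast
    then have "P (\<rho> + e) w"
      unfolding P_def by (auto elim: eventually_mono)
    then show ?thesis ..
  qed
  \<comment> \<open>If the bound failed, the midpoint of \<open>a\<close> and \<open>b\<close> would
    be a center with squared radius below the infimum \<open>\<rho>\<close>.\<close>
  have close: "(norm (a - b))\<^sup>2 \<le> 4 * e" if "P (\<rho> + e) a" "P (\<rho> + e) b" for a b e
  proof -
    have "P (\<rho> + e - (norm (a - b))\<^sup>2 / 4) ((1/2) *\<^sub>R (a + b))"
      using that unfolding P_def
    proof eventually_elim
      case (elim j)
      then show ?case
        by (simp add: parallelogram_midpoint)
    qed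
    from \<rho>_le[OF this] show ?thesis
      by simp
  qed
  have mono: "P t w" if "P s w" "s \<le> t" for s t w
    using that unfolding P_def by (auto elim: eventually_mono)
  define \<epsilon> where "\<epsilon> n = 1 / real (Suc n)" for n
  have \<epsilon>0: "\<epsilon> \<longlonglongrightarrow> 0"
    unfolding \<epsilon>_def by (rule LIMSEQ_Suc[OF lim_1_over_n])
  \<comment> \<open>A minimizing sequence of centers; by \<open>close\<close> it is Cauchy, and its
    limit is the desired point.\<close>
  obtain u where u: "\<And>n. P (\<rho> + \<epsilon> n) (u n)"
    using near[of "\<epsilon> _"] unfolding \<epsilon>_def by (metis of_nat_0_less_iff zero_less_Suc zero_less_divide_1_iff)
  have "Cauchy u"
  proof (rule metric_CauchyI)
    fix e :: real
    assume e: "e > 0"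
    then have "e\<^sup>2 / 4 > 0"
      by simp
    from order_tendstoD(2)[OF \<epsilon>0 this]
    obtain N where N: "\<And>n. n \<ge> N \<Longrightarrow> \<epsilon> n < e\<^sup>2 / 4"
      unfolding eventually_sequentially by blast
    have "dist (u m) (u n) < e" if "m \<ge> N" "n \<ge> N" for m n
    proof -
      have "P (\<rho> + max (\<epsilon> m) (\<epsilon> n)) (u m)" "P (\<rho> + max (\<epsilon> m) (\<epsilon> n)) (u n)"
        by (rule mono[OF u], simp)+
      from close[OF this] have "(norm (u m - u n))\<^sup>2 < e\<^sup>2"
        using N[OF that(1)] N[OF that(2)] by linarith
      then show ?thesis
        using e by (simp add: dist_norm power2_less_imp_less)
    qed
    then show "\<exists>N. \<forall>m\<ge>N. \<forall>n\<ge>N. dist (u m) (u n) < e"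
      by blast
  qed
  then obtain z where z: "u \<longlonglongrightarrow> z"
    using Cauchy_convergent convergent_def by blast
  \<comment> \<open>The gap \<open>g\<close> between the two roots is split: one half pays for
    replacing \<open>u n\<close> by \<open>z\<close>, the other remains as the slack
    \<open>e\<close> that a competitor \<open>w\<close> may use up.\<close>
  have Pz: "\<exists>e>0. \<forall>\<^sub>F j in F. norm (y j - z) + e \<le> sqrt (\<rho> + \<delta>)" if "\<delta> > 0" for \<delta>
  proof -
    define g where "g = sqrt (\<rho> + \<delta>) - sqrt (\<rho> + \<delta> / 2)"
    have g: "g > 0"
      using that unfolding g_def by simp
    have "\<forall>\<^sub>F n in sequentially. \<epsilon> n < \<delta> / 2"
      using order_tendstoD(2)[OF \<epsilon>0, of "\<delta> / 2"] that by simp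
    moreover have "\<forall>\<^sub>F n in sequentially. dist (u n) z < g / 2"
      using tendstoD[OF z, of "g / 2"] g by simp
    ultimately have "\<forall>\<^sub>F n in sequentially. \<epsilon> n < \<delta> / 2 \<and> dist (u n) z < g / 2"
      by (rule eventually_conj)
    then obtain n where n: "\<epsilon> n < \<delta> / 2" "dist (u n) z < g / 2"
      using eventually_happens' sequentially_bot by blast
    have "P (\<rho> + \<delta> / 2) (u n)"
      using mono[OF u] n(1) by simp
    then have "\<forall>\<^sub>F j in F. norm (y j - z) + g / 2 \<le> sqrt (\<rho> + \<delta>)"
      unfolding P_def
    proof eventually_elim
      case (elim j)
      then have "norm (y j - u n) \<le> sqrt (\<rho> + \<delta> / 2)"
        by (rule real_le_rsqrt)
      moreover have "norm (y j - z) \<le> norm (y j - u n) + dist (u n) z"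
        using norm_triangle_ineq[of "y j - u n" "u n - z"] by (simp add: dist_norm)
      ultimately show ?case
        using n(2) unfolding g_def by (simp add: field_simps)
    qed
    with g show ?thesis
      by (intro exI[of _ "g / 2"]) simp
  qed
  show ?thesis
  proof (rule that[of z])
    fix w
    assume w: "\<And>e. e > 0 \<Longrightarrow> \<forall>\<^sub>F j in F. norm (y j - w) \<le> norm (y j - z) + e"
    have *: "(norm (w - z))\<^sup>2 \<le> 4 * \<delta>" if "\<delta> > 0" for \<delta>
    proof -
      obtain e where e: "e > 0" "\<forall>\<^sub>F j in F. norm (y j - z) + e \<le> sqrt (\<rho> + \<delta>)"
        using Pz[OF \<open>\<delta> > 0\<close>] by blast
      have sq: "t\<^sup>2 \<le> \<rho> + \<delta>" if "0 \<le> t" "t \<le> sqrt (\<rho> + \<delta>)" for t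
        using that by (metis abs_of_nonneg real_sqrt_abs real_sqrt_le_iff)
      have "P (\<rho> + \<delta>) w"
        unfolding P_def using w[OF e(1)] e(2)
        by eventually_elim (rule sq, auto)
      moreover have "P (\<rho> + \<delta>) z"
        unfolding P_def using e(2)
        by eventually_elim (rule sq, use e(1) in auto)
      ultimately show ?thesis
        by (rule close)
    qed
    have "(norm (w - z))\<^sup>2 \<le> 0"
    proof (rule field_le_epsilon)
      fix e :: real
      assume "e > 0"
      then show "(norm (w - z))\<^sup>2 \<le> 0 + e"
        using *[of "e / 4"] by simp
    qed
    then show "w = z"
      by simp
  qed
qed

text \<open>As \<open>U (y j)\<close> is close to \<open>y j\<close>, the point \<open>U z\<close>
  is asymptotically no farther from \<open>y\<close> than the center \<open>z\<close>, so both
  coincide. A general filter covers subsequences without naming their indices.\<close>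

lemma nonexpansive_fixed_point_if_approximate:
  fixes U :: "'a::{real_inner,complete_space} \<Rightarrow> 'a"
  assumes ne: "nonexpansive U" and F: "F \<noteq> bot"
    and bd: "\<forall>\<^sub>F j in F. norm (y j) \<le> r"
    and approx: "((\<lambda>j. U (y j) - y j) \<longlongrightarrow> 0) F"
  shows "\<exists>z. U z = z"
proof -
  obtain z where z: "\<And>w. (\<And>e. e > 0 \<Longrightarrow> \<forall>\<^sub>F j in F. norm (y j - w) \<le> norm (y j - z) + e) \<Longrightarrow> w = z"
    using asymptotic_center[OF F bd] by blast
  have "U z = z"
  proof (rule z)
    fix e :: real
    assume "e > 0"
    then have "\<forall>\<^sub>F j in F. norm (U (y j) - y j) < e"
      using approx unfolding tendsto_iff by simp
    then show "\<forall>\<^sub>F j in F. norm (y j - U z) \<le> norm (y j - z) + e"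
    proof eventually_elim
      case (elim j)
      have "norm (y j - U z) \<le> norm (y j - U (y j)) + norm (U (y j) - U z)"
        using norm_triangle_ineq[of "y j - U (y j)" "U (y j) - U z"] by simp
      then show ?case
        using elim nonexpansiveD[OF ne, of "y j" z] by (simp add: norm_minus_commute)
    qed
  qed
  then show ?thesis ..
qed

section \<open>Orbits of strongly nonexpansive maps\<close>

lemma strongly_nonexpansive_orbit_steps:
  fixes U :: "'a::real_normed_vector \<Rightarrow> 'a" and x :: 'a
  assumes sne: "strongly_nonexpansive U"
  defines "v \<equiv> \<lambda>k. (U ^^ Suc k) x - (U ^^ k) x"
  obtains d where "(\<lambda>k. norm (v k)) \<longlonglongrightarrow> d" "\<And>m. real m * d \<le> norm ((U ^^ m) x - x)"
proof -
  have ne: "nonexpansive U"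
    using sne by (simp add: strongly_nonexpansive_def)
  have "decseq (\<lambda>k. norm (v k))"
    unfolding v_def by (intro decseq_SucI) (simp add: nonexpansiveD[OF ne])
  then obtain d where d: "(\<lambda>k. norm (v k)) \<longlonglongrightarrow> d" and d_le: "\<And>k. d \<le> norm (v k)"
    using decseq_convergent[of "\<lambda>k. norm (v k)" 0] by auto
  have "bdd_above (range (\<lambda>k. norm ((U ^^ Suc k) x - (U ^^ k) x)))"
    using decseqD[OF \<open>decseq _\<close>, of 0] unfolding v_def
    by (intro bdd_aboveI[of _ "norm (v 0)"]) (auto simp: v_def)
  moreover have "(\<lambda>k. norm ((U ^^ Suc k) x - (U ^^ k) x) - norm (U ((U ^^ Suc k) x) - U ((U ^^ k) x)))
      \<longlonglongrightarrow> 0"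
    using tendsto_diff[OF d LIMSEQ_Suc[OF d]] by (simp add: v_def)
  ultimately have "(\<lambda>k. ((U ^^ Suc k) x - (U ^^ k) x) - (U ((U ^^ Suc k) x) - U ((U ^^ k) x))) \<longlonglongrightarrow> 0"
    using sne[unfolded strongly_nonexpansive_def, THEN conjunct2, rule_format,
        of "\<lambda>k. (U ^^ Suc k) x" "\<lambda>k. (U ^^ k) x"] by blast
  from tendsto_minus[OF this] have v0: "(\<lambda>k. v (Suc k) - v k) \<longlonglongrightarrow> 0"
    by (simp add: v_def)
  have lim: "(\<lambda>k. (U ^^ (k + m)) x - (U ^^ k) x - real m *\<^sub>R v k) \<longlonglongrightarrow> 0" for m
  proof (induction m)
    case 0
    show ?case by simp
  next
    case (Suc m)
    \<comment> \<open>The induction hypothesis is taken at \<open>Suc k\<close>; exchanging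
      \<open>v (Suc k)\<close> for \<open>v k\<close> costs a multiple of their difference, which
      tends to 0.\<close>
    have "(\<lambda>k. ((U ^^ (Suc k + m)) x - (U ^^ Suc k) x - real m *\<^sub>R v (Suc k))
        + real m *\<^sub>R (v (Suc k) - v k)) \<longlonglongrightarrow> 0 + real m *\<^sub>R 0"
      by (intro tendsto_add tendsto_scaleR tendsto_const LIMSEQ_Suc[OF Suc.IH] v0)
    moreover have "((U ^^ (Suc k + m)) x - (U ^^ Suc k) x - real m *\<^sub>R v (Suc k))
        + real m *\<^sub>R (v (Suc k) - v k) = (U ^^ (k + Suc m)) x - (U ^^ k) x - real (Suc m) *\<^sub>R v k" for k
      by (simp add: v_def algebra_simps)
    ultimately show ?case
      by (simp only: add_0_left scaleR_zero_right)
  qed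
  \<comment> \<open>With \<open>m\<close> fixed, letting \<open>k\<close> tend to infinity removes
    the error term. The rest holds for every \<open>k\<close>: \<open>norm (v k)\<close> stays above
    its limit \<open>d\<close>, and \<open>U ^^ k\<close> expands no distance.\<close>
  have "real m * d \<le> norm ((U ^^ m) x - x)" for m
  proof -
    have "real m * d - norm ((U ^^ (k + m)) x - (U ^^ k) x - real m *\<^sub>R v k)
        \<le> norm ((U ^^ m) x - x)" for k
    proof -
      have "real m * d \<le> norm (real m *\<^sub>R v k)"
        using d_le[of k] by (simp add: mult_left_mono)
      moreover have "norm ((U ^^ (k + m)) x - (U ^^ k) x) \<le> norm ((U ^^ m) x - x)"
        using nonexpansiveD[OF nonexpansive_funpow[OF ne], of k "(U ^^ m) x" x]
        by (simp add: funpow_add)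
      moreover have "norm (real m *\<^sub>R v k) \<le> norm ((U ^^ (k + m)) x - (U ^^ k) x)
          + norm ((U ^^ (k + m)) x - (U ^^ k) x - real m *\<^sub>R v k)"
        using norm_triangle_sub[of "real m *\<^sub>R v k" "(U ^^ (k + m)) x - (U ^^ k) x"]
        by (simp add: norm_minus_commute)
      ultimately show ?thesis by linarith
    qed
    moreover have "(\<lambda>k. real m * d - norm ((U ^^ (k + m)) x - (U ^^ k) x - real m *\<^sub>R v k))
        \<longlonglongrightarrow> real m * d - 0"
      by (intro tendsto_diff tendsto_const tendsto_norm_zero lim)
    ultimately show ?thesis
      by (intro LIMSEQ_le_const2) auto
  qed
  with d that show ?thesis
    by blast
qed

lemma strongly_nonexpansive_orbit_diverges:
  fixes U :: "'a::{real_inner,complete_space} \<Rightarrow> 'a"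
  assumes sne: "strongly_nonexpansive U" and fpf: "fixed_point_free U"
  shows "filterlim (\<lambda>k. norm ((U ^^ k) x)) at_top sequentially"
proof -
  obtain d where d: "(\<lambda>k. norm ((U ^^ Suc k) x - (U ^^ k) x)) \<longlonglongrightarrow> d"
    and le: "\<And>m. real m * d \<le> norm ((U ^^ m) x - x)"
    using strongly_nonexpansive_orbit_steps[OF sne] by blast
  have "d \<ge> 0"
    by (rule LIMSEQ_le_const[OF d]) auto
  then consider "d > 0" | "d = 0"
    by linarith
  then show ?thesis
  proof cases
    case 1
    have "filterlim (\<lambda>m. real m * d) at_top sequentially"
      by (rule filterlim_at_top_mult_tendsto_pos[OF tendsto_const 1 filterlim_real_sequentially])
    then have "filterlim (\<lambda>m. - norm x + real m * d) at_top sequentially"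
      by (rule filterlim_tendsto_add_at_top[OF tendsto_const])
    moreover have "- norm x + real m * d \<le> norm ((U ^^ m) x)" for m
      using le[of m] norm_triangle_ineq4[of "(U ^^ m) x" x] by linarith
    ultimately show ?thesis
      by (rule filterlim_at_top_mono[OF _ always_eventually[OF allI]])
  next
    case 2
    show ?thesis
    proof (rule ccontr)
      assume "\<not> ?thesis"
      then obtain r where r: "\<not> (\<forall>\<^sub>F k in sequentially. r < norm ((U ^^ k) x))"
        unfolding filterlim_at_top_dense by blast
      \<comment> \<open>This filter plays the role of a bounded subsequence: it keeps only the times
        spent in the ball of radius \<open>r\<close>, and it is proper because such times recur
        beyond every index.\<close>
      define F where "F = inf sequentially (principal {k. norm ((U ^^ k) x) \<le> r})"
      have "F \<noteq> bot"
        using r unfolding F_def trivial_limit_def eventually_inf_principal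
        by (simp add: not_le)
      moreover have "\<forall>\<^sub>F k in F. norm ((U ^^ k) x) \<le> r"
        unfolding F_def eventually_inf_principal by simp
      moreover have "((\<lambda>k. U ((U ^^ k) x) - (U ^^ k) x) \<longlongrightarrow> 0) F"
        using d 2 unfolding F_def
        by (intro tendsto_mono[OF inf_le1]) (simp add: tendsto_norm_zero_iff)
      moreover have "nonexpansive U"
        using sne by (simp add: strongly_nonexpansive_def)
      ultimately have "\<exists>z. U z = z"
        by (intro nonexpansive_fixed_point_if_approximate)
      with fpf show False
        by (simp add: fixed_point_free_def)
    qed
  qed
qed

theorem theorem9:
  fixes I :: "'i set"
    and T :: "'i \<Rightarrow> 'a::real_normed_vector \<Rightarrow> 'a"
    and c :: "nat \<Rightarrow> 'i"
  assumes "I \<noteq> {}"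
    and "\<And>i. i \<in> I \<Longrightarrow> nonexpansive (T i)"
    and "\<And>k. c k \<in> I"
  shows
    "((\<exists>x. bounded (range (\<lambda>k. iter_comp T c k x))) \<longrightarrow>
        uniformly_bounded_on_bounded_sets (iter_comp T c) \<and>
        (\<forall>y. bounded (range (\<lambda>k. iter_comp T c k y))))
   \<and> ((\<exists>x. bounded (range (\<lambda>k. iter_comp T c k x))) \<longleftrightarrow>
        (\<forall>x. bounded (range (\<lambda>k. iter_comp T c k x))))
   \<and> ((\<exists>x. filterlim (\<lambda>k. norm (iter_comp T c k x)) at_top sequentially) \<longrightarrow>
        norm_diverges_uniformly_on_bounded_sets (iter_comp T c) \<and>
        (\<forall>y. filterlim (\<lambda>k. norm (iter_comp T c k y)) at_top sequentially))
   \<and> ((\<exists>x. \<not> bounded (range (\<lambda>k. iter_comp T c k x))) \<longleftrightarrow>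
        (\<forall>x. \<not> bounded (range (\<lambda>k. iter_comp T c k x))))
   \<and> ((\<exists>v::'h::{real_inner,complete_space}. v \<noteq> 0) \<longrightarrow>
        (\<forall>U :: 'h \<Rightarrow> 'h. strongly_nonexpansive U \<and> fixed_point_free U \<longrightarrow>
           norm_diverges_uniformly_on_bounded_sets (\<lambda>k. U ^^ k)))"
proof -
  have ne: "nonexpansive (iter_comp T c k)" for k
    using assms by (intro nonexpansive_iter_comp) auto
  have ub: "uniformly_bounded_on_bounded_sets (iter_comp T c)
      \<and> (\<forall>y. bounded (range (\<lambda>k. iter_comp T c k y)))"
    if "bounded (range (\<lambda>k. iter_comp T c k x))" for x
    using uniformly_bounded_if_bounded_orbit[OF ne that] bounded_orbit_if_uniformly_bounded by blast
  have div: "norm_diverges_uniformly_on_bounded_sets (iter_comp T c)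
      \<and> (\<forall>y. filterlim (\<lambda>k. norm (iter_comp T c k y)) at_top sequentially)"
    if "filterlim (\<lambda>k. norm (iter_comp T c k x)) at_top sequentially" for x
    using norm_diverges_uniformly_if_orbit_diverges[OF ne that]
      orbit_diverges_if_norm_diverges_uniformly by blast
  have hilbert: "norm_diverges_uniformly_on_bounded_sets (\<lambda>k. U ^^ k)"
    if "strongly_nonexpansive U" "fixed_point_free U" for U :: "'h \<Rightarrow> 'h"
  proof (rule norm_diverges_uniformly_if_orbit_diverges)
    show "nonexpansive (U ^^ k)" for k
      using that by (simp add: strongly_nonexpansive_def nonexpansive_funpow)
  qed (rule strongly_nonexpansive_orbit_diverges[OF that, of 0])
  \<comment> \<open>The two equivalences come from \<open>ub\<close>: one bounded orbit makes all
    orbits bounded, and the contrapositive treats unbounded ones.\<close>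
  show ?thesis
    using ub div hilbert by blast
qed

end
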